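(* Algorithm UniversalBasis has runtime $O\!\left((kn_1+k^2n_0)/\sqrt{\bar\epsilon}\right)$.
   Context: $M$ is a well-centered, shape-regular finite simplicial triangulation of a boundaryless Riemannian $m$-manifold, $M'$ its circumcentric dual polytopal complex, and $X\in\{M,M'\}$. $X_0=\{\tau_{0,i}\}$ and $X_1=\{\tau_{1,l}\}$ are the sets of vertices and edges of $X$, with $n_0$ and $n_1$ elements. $\star_1$ is the diagonal discrete Hodge star on $1$-cochains of $X$, $\star_1(l,l)=|\ast\tau_{1,l}|/|\tau_{1,l}|$, with $\ast\tau_{1,l}$ the dual cell of $\tau_{1,l}$. Algorithm UniversalBasis. Input: $(X_0,X_1,\star_1)$ and a relative-error tolerance $\epsilon>\rho_Ms$, where $s$ is the relative volume deviation of the mesh and $\rho_M$ is a mesh-dependent constant. Steps: (1) set $k\leftarrow\epsilon/(\rho_Ms)$; (2) for each edge $\tau_{1,l}=(\tau_{0,i},\tau_{0,j})$ set $L[i,j]\leftarrow-\star_1(l,l)$; (3) set $\mathrm{Diagonal}(L)\leftarrow-L\mathbf{1}_{n_0}$; (4) $\tilde V_k\leftarrow\mathrm{LaplacianEig}(L,k)$; (5) return $\tilde V_k\in\mathbb{R}^{n_0\times k}$, with $\tilde V_k^\top\tilde V_k=I_k$. Here LaplacianEig is an eigensolver computing, with relative error $\bar\epsilon$, the eigenvectors for the bottom $k$ eigenvalues of the graph Laplacian $L$ in $O((n_1k+n_0k^2)/\sqrt{\bar\epsilon})$ floating point operations. *)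

theory Defs
  imports
    "HOL-Analysis.Analysis"
    "HOL-Library.Landau_Symbols"
    "HOL-Library.Monad_Syntax"
    "Jordan_Normal_Form.Determinant"
begin

section \<open>Piecewise flat simplicial meshes\<close>

text \<open>
  A mesh is a finite abstract simplicial complex whose simplices carry flat metrics that agree on
  common faces. The flat metric of a simplex \<^term>\<open>\<sigma>\<close> is given by positions of its vertices in
  $\mathbb{R}^m$; different simplices are placed independently of each other, so that no
  embedding of the whole mesh into a Euclidean space is assumed. As in the library's
  \<^const>\<open>Euclidean_space\<close>, the points of $\mathbb{R}^m$ are the functions on \<^typ>\<open>nat\<close> that
  vanish from index \<open>m\<close> on.
\<close>

type_synonym point = "nat \<Rightarrow> real"

record mesh =
  mdim :: nat
  simplices :: "nat set set"
  position :: "nat set \<Rightarrow> nat \<Rightarrow> point"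

definition points :: "nat \<Rightarrow> point set" where
  "points m = topspace (Euclidean_space m)"

definition edist :: "nat \<Rightarrow> point \<Rightarrow> point \<Rightarrow> real" where
  "edist m x y = L2_set (\<lambda>i. x i - y i) {..<m}"

definition barycentric_point :: "(nat \<Rightarrow> point) \<Rightarrow> nat set \<Rightarrow> (nat \<Rightarrow> real) \<Rightarrow> point" where
  "barycentric_point p \<sigma> a = (\<lambda>i. \<Sum>v\<in>\<sigma>. a v * p v i)"

definition simplex_hull :: "(nat \<Rightarrow> point) \<Rightarrow> nat set \<Rightarrow> point set" where
  "simplex_hull p \<sigma> = {barycentric_point p \<sigma> a |a. (\<forall>v\<in>\<sigma>. 0 \<le> a v) \<and> (\<Sum>v\<in>\<sigma>. a v) = 1}"

definition affinely_independent :: "(nat \<Rightarrow> point) \<Rightarrow> nat set \<Rightarrow> bool" where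
  "affinely_independent p \<sigma> \<longleftrightarrow>
     (\<forall>a. (\<Sum>v\<in>\<sigma>. a v) = 0 \<and> barycentric_point p \<sigma> a = (\<lambda>i. 0) \<longrightarrow> (\<forall>v\<in>\<sigma>. a v = 0))"

definition finite_simplicial_complex :: "nat \<Rightarrow> nat set set \<Rightarrow> bool" where
  "finite_simplicial_complex m K \<longleftrightarrow>
     finite K \<and> K \<noteq> {} \<and>
     (\<forall>\<sigma>\<in>K. finite \<sigma> \<and> \<sigma> \<noteq> {}) \<and>
     (\<forall>\<sigma>\<in>K. \<forall>\<tau>. \<tau> \<subseteq> \<sigma> \<and> \<tau> \<noteq> {} \<longrightarrow> \<tau> \<in> K) \<and>
     (\<forall>\<sigma>\<in>K. \<exists>\<tau>\<in>K. \<sigma> \<subseteq> \<tau> \<and> card \<tau> = m + 1)"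

definition flat_metric :: "mesh \<Rightarrow> bool" where
  "flat_metric M \<longleftrightarrow>
     (\<forall>\<sigma>\<in>simplices M. position M \<sigma> ` \<sigma> \<subseteq> points (mdim M) \<and>
        affinely_independent (position M \<sigma>) \<sigma>) \<and>
     (\<forall>\<sigma>\<in>simplices M. \<forall>\<tau>\<in>simplices M. \<tau> \<subseteq> \<sigma> \<longrightarrow>
        (\<forall>v\<in>\<tau>. \<forall>w\<in>\<tau>. edist (mdim M) (position M \<tau> v) (position M \<tau> w) =
                      edist (mdim M) (position M \<sigma> v) (position M \<sigma> w)))"

definition geometric_realization :: "nat set set \<Rightarrow> (nat \<Rightarrow> real) topology" where
  "geometric_realization K = subtopology (powertop_real UNIV)
     {x. (\<forall>v. 0 \<le> x v) \<and> {v. x v \<noteq> 0} \<in> K \<and> (\<Sum>v | x v \<noteq> 0. x v) = 1}"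

text \<open>
  The realization of a finite complex is compact, Hausdorff and second countable, so for it this
  property says that it is a closed \<open>m\<close>-manifold.
\<close>

definition locally_Euclidean :: "nat \<Rightarrow> 'a topology \<Rightarrow> bool" where
  "locally_Euclidean m T \<longleftrightarrow>
     (\<forall>x\<in>topspace T. \<exists>U. openin T U \<and> x \<in> U \<and> subtopology T U homeomorphic_space Euclidean_space m)"

definition triangulated_manifold :: "mesh \<Rightarrow> bool" where
  "triangulated_manifold M \<longleftrightarrow>
     0 < mdim M \<and> finite_simplicial_complex (mdim M) (simplices M) \<and> flat_metric M \<and>
     locally_Euclidean (mdim M) (geometric_realization (simplices M))"

definition circumcenter :: "nat \<Rightarrow> (nat \<Rightarrow> point) \<Rightarrow> nat set \<Rightarrow> point" where
  "circumcenter m p \<sigma> =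
     (THE c. (\<exists>a. (\<Sum>v\<in>\<sigma>. a v) = 1 \<and> c = barycentric_point p \<sigma> a) \<and>
             (\<exists>r. \<forall>v\<in>\<sigma>. edist m c (p v) = r))"

definition well_centered :: "mesh \<Rightarrow> bool" where
  "well_centered M \<longleftrightarrow>
     (\<forall>\<sigma>\<in>simplices M. \<exists>a. (\<forall>v\<in>\<sigma>. 0 < a v) \<and> (\<Sum>v\<in>\<sigma>. a v) = 1 \<and>
        circumcenter (mdim M) (position M \<sigma>) \<sigma> = barycentric_point (position M \<sigma>) \<sigma> a)"

definition simplex_diameter :: "mesh \<Rightarrow> nat set \<Rightarrow> real" where
  "simplex_diameter M \<sigma> =
     Max ((\<lambda>(v, w). edist (mdim M) (position M \<sigma> v) (position M \<sigma> w)) ` (\<sigma> \<times> \<sigma>))"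

text \<open>The ratio of diameter to inradius of every top-dimensional simplex is at most \<open>\<kappa>\<close>.\<close>

definition shape_regular :: "real \<Rightarrow> mesh \<Rightarrow> bool" where
  "shape_regular \<kappa> M \<longleftrightarrow>
     (\<forall>\<sigma>\<in>simplices M. card \<sigma> = mdim M + 1 \<longrightarrow>
        (\<exists>c\<in>points (mdim M). \<forall>x\<in>points (mdim M).
           edist (mdim M) x c \<le> simplex_diameter M \<sigma> / \<kappa> \<longrightarrow> x \<in> simplex_hull (position M \<sigma>) \<sigma>))"


section \<open>Circumcentric dual and the discrete Hodge star on 1-cochains\<close>

text \<open>
  The volume of the \<open>d\<close>-simplex spanned by points $p_0, \dots, p_d$ of $\mathbb{R}^m$, by the
  Gram determinant of the edge vectors $p_i - p_0$. For \<open>d = 0\<close> it is \<open>1\<close>.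
\<close>

definition simplex_volume :: "nat \<Rightarrow> point list \<Rightarrow> real" where
  "simplex_volume m ps =
     (let d = length ps - 1 in
      sqrt (Determinant.det (mat d d (\<lambda>(i, j).
        \<Sum>k<m. ((ps ! Suc i) k - (ps ! 0) k) * ((ps ! Suc j) k - (ps ! 0) k)))) / fact d)"

definition cell_volume :: "mesh \<Rightarrow> nat set \<Rightarrow> real" where
  "cell_volume M \<tau> = simplex_volume (mdim M) (map (position M \<tau>) (sorted_list_of_set \<tau>))"

definition flags :: "mesh \<Rightarrow> nat set \<Rightarrow> nat set list set" where
  "flags M \<tau> = {F. F \<noteq> [] \<and> hd F = \<tau> \<and> set F \<subseteq> simplices M \<and> card (last F) = mdim M + 1 \<and>
     successively (\<lambda>\<sigma> \<sigma>'. \<sigma> \<subset> \<sigma>' \<and> card \<sigma>' = card \<sigma> + 1) F}"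

text \<open>
  The dual cell of \<open>\<tau>\<close> is the union, over all flags $\tau = \sigma_p \subset \dots \subset \sigma_m$,
  of the simplices spanned by the circumcenters of $\sigma_p, \dots, \sigma_m$. These simplices do
  not overlap because the mesh is well-centered, and each of them lies in the flat simplex
  $\sigma_m$.
\<close>

definition dual_cell_volume :: "mesh \<Rightarrow> nat set \<Rightarrow> real" where
  "dual_cell_volume M \<tau> =
     (\<Sum>F\<in>flags M \<tau>. simplex_volume (mdim M) (map (circumcenter (mdim M) (position M (last F))) F))"

text \<open>
  A cell of the dual complex is represented by the simplex it is dual to. So the vertices of the
  dual complex are the \<open>m\<close>-simplices, its edges are the \<open>(m-1)\<close>-simplices, and a vertex is an
  endpoint of an edge if the corresponding \<open>m\<close>-simplex contains the corresponding
  \<open>(m-1)\<close>-simplex.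
\<close>

datatype complex_kind = Primal | Circumcentric_Dual

fun vertex_cells :: "mesh \<Rightarrow> complex_kind \<Rightarrow> nat set set" where
  "vertex_cells M Primal = {\<sigma>\<in>simplices M. card \<sigma> = 1}"
| "vertex_cells M Circumcentric_Dual = {\<sigma>\<in>simplices M. card \<sigma> = mdim M + 1}"

fun edge_cells :: "mesh \<Rightarrow> complex_kind \<Rightarrow> nat set set" where
  "edge_cells M Primal = {\<sigma>\<in>simplices M. card \<sigma> = 2}"
| "edge_cells M Circumcentric_Dual = {\<sigma>\<in>simplices M. card \<sigma> = mdim M}"

fun endpoints :: "mesh \<Rightarrow> complex_kind \<Rightarrow> nat set \<Rightarrow> nat set set" where
  "endpoints M Primal \<tau> = {\<sigma>\<in>vertex_cells M Primal. \<sigma> \<subseteq> \<tau>}"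
| "endpoints M Circumcentric_Dual \<tau> = {\<sigma>\<in>vertex_cells M Circumcentric_Dual. \<tau> \<subseteq> \<sigma>}"

fun hodge_star1 :: "mesh \<Rightarrow> complex_kind \<Rightarrow> nat set \<Rightarrow> real" where
  "hodge_star1 M Primal \<tau> = dual_cell_volume M \<tau> / cell_volume M \<tau>"
| "hodge_star1 M Circumcentric_Dual \<tau> = cell_volume M \<tau> / dual_cell_volume M \<tau>"


section \<open>Computations with cost\<close>

text \<open>
  Unit-cost real RAM: \<open>tick\<close> charges one unit for an elementary operation, which is an arithmetic
  operation or an access to memory. Floating point operations are thus counted, and
  so is the data movement between them.
\<close>

datatype 'a timed = Timed (result: 'a) (cost: nat)

definition return :: "'a \<Rightarrow> 'a timed" where
  "return x = Timed x 0"

definition tick :: "'a \<Rightarrow> 'a timed" where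
  "tick x = Timed x 1"

definition bind_timed :: "'a timed \<Rightarrow> ('a \<Rightarrow> 'b timed) \<Rightarrow> 'b timed" where
  "bind_timed c f = Timed (result (f (result c))) (cost c + cost (f (result c)))"

adhoc_overloading Monad_Syntax.bind \<rightleftharpoons> bind_timed

text \<open>
  Sparse matrices in coordinate format: a list of stored entries. As usual for this format, entries
  that are stored repeatedly at a position add up. Storing an entry at a position where there is
  none yet is an assignment.
\<close>

type_synonym sparse_matrix = "((nat \<times> nat) \<times> real) list"

definition to_mat :: "nat \<Rightarrow> sparse_matrix \<Rightarrow> real mat" where
  "to_mat n L = mat n n (\<lambda>ij. \<Sum>e\<leftarrow>filter (\<lambda>e. fst e = ij) L. snd e)"


section \<open>Eigensolvers for graph Laplacians\<close>

text \<open>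
  The sparse matrix \<open>L\<close> stores the Laplacian of a weighted graph with vertices \<open>0, \<dots>, n - 1\<close>
  and set of edges \<open>E\<close>, an edge being given as the pair \<open>(i, j)\<close> of its ends with \<open>i < j\<close>. Exactly
  the positions on the diagonal and those belonging to edges are stored.
\<close>

definition sparse_graph_Laplacian :: "nat \<Rightarrow> (nat \<times> nat) set \<Rightarrow> sparse_matrix \<Rightarrow> bool" where
  "sparse_graph_Laplacian n E L \<longleftrightarrow>
     E \<subseteq> {(i, j). i < j \<and> j < n} \<and>
     distinct (map fst L) \<and> set (map fst L) = {(i, i) |i. i < n} \<union> E \<union> E\<inverse> \<and>
     (\<exists>w. (\<forall>e\<in>E. (0::real) \<le> w e) \<and>
        to_mat n L = mat n n (\<lambda>(i, j).
          if i = j then \<Sum>e\<in>{e\<in>E. i = fst e \<or> i = snd e}. w e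
          else if (i, j) \<in> E then - w (i, j)
          else if (j, i) \<in> E then - w (j, i)
          else 0))"

definition vec_length :: "real vec \<Rightarrow> real" where
  "vec_length v = sqrt (scalar_prod v v)"

text \<open>
  The columns of \<open>U\<close> are an orthonormal eigenbasis of \<open>A\<close>, ordered by eigenvalue; the first \<open>k\<close>
  of them are approximated by the columns of \<open>V\<close> with relative error \<open>\<delta>\<close>.
\<close>

definition bottom_eigenvectors :: "real \<Rightarrow> real mat \<Rightarrow> nat \<Rightarrow> real mat \<Rightarrow> bool" where
  "bottom_eigenvectors \<delta> A k V \<longleftrightarrow>
     V \<in> carrier_mat (dim_row A) k \<and> transpose_mat V * V = 1\<^sub>m k \<and>
     (\<exists>U \<mu>. U \<in> carrier_mat (dim_row A) (dim_row A) \<and> transpose_mat U * U = 1\<^sub>m (dim_row A) \<and>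
        mono_on {..<dim_row A} \<mu> \<and>
        (\<forall>j<dim_row A. A *\<^sub>v col U j = \<mu> j \<cdot>\<^sub>v col U j) \<and>
        (\<forall>j<k. vec_length (col V j - col U j) \<le> \<delta> * vec_length (col U j)))"

type_synonym eigensolver = "real \<Rightarrow> nat \<Rightarrow> sparse_matrix \<Rightarrow> nat \<Rightarrow> real mat timed"

definition eigensolver_inputs :: "(real \<times> nat \<times> (nat \<times> nat) set \<times> sparse_matrix \<times> nat) set" where
  "eigensolver_inputs =
     {(\<delta>, n, E, L, k). 0 < \<delta> \<and> \<delta> < 1 \<and> sparse_graph_Laplacian n E L \<and> 1 \<le> k \<and> k \<le> n}"

text \<open>
  Landau's symbol is taken with respect to the principal filter of the admissible inputs, so the
  bound holds on all of them with a single constant.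
\<close>

definition is_LaplacianEig :: "eigensolver \<Rightarrow> bool" where
  "is_LaplacianEig eig \<longleftrightarrow>
     (\<forall>(\<delta>, n, E, L, k)\<in>eigensolver_inputs.
        bottom_eigenvectors \<delta> (to_mat n L) k (result (eig \<delta> n L k))) \<and>
     (\<lambda>(\<delta>, n, E, L, k). real (cost (eig \<delta> n L k)))
       \<in> O[principal eigensolver_inputs](\<lambda>(\<delta>, n, E, L, k).
            (real (card E) * real k + real n * (real k)\<^sup>2) / sqrt \<delta>)"


section \<open>The algorithm\<close>

record ub_input =
  num_vertices :: nat
  edges :: "(nat \<times> nat) list"
  star1 :: "real list"

text \<open>The input lists the vertices and edges of the complex in an arbitrary order and orientation.\<close>

definition encodes :: "mesh \<Rightarrow> complex_kind \<Rightarrow> ub_input \<Rightarrow> bool" where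
  "encodes M X I \<longleftrightarrow>
     (\<exists>\<tau>0 \<tau>1.
        bij_betw \<tau>0 {..<num_vertices I} (vertex_cells M X) \<and>
        bij_betw \<tau>1 {..<length (edges I)} (edge_cells M X) \<and>
        length (star1 I) = length (edges I) \<and>
        (\<forall>l<length (edges I).
           (case edges I ! l of (i, j) \<Rightarrow>
              i < num_vertices I \<and> j < num_vertices I \<and> i \<noteq> j \<and>
              endpoints M X (\<tau>1 l) = {\<tau>0 i, \<tau>0 j}) \<and>
           star1 I ! l = hodge_star1 M X (\<tau>1 l)))"

fun off_diagonal :: "(nat \<times> nat) list \<Rightarrow> real list \<Rightarrow> sparse_matrix \<Rightarrow> sparse_matrix timed" where
  "off_diagonal (e # es) (w # ws) L = do {
     (i, j) \<leftarrow> tick e;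
     x \<leftarrow> tick w;
     y \<leftarrow> tick (- x);
     L \<leftarrow> tick (((i, j), y) # L);
     L \<leftarrow> tick (((j, i), y) # L);
     off_diagonal es ws L
   }"
| "off_diagonal _ _ L = return L"

fun constant_vector :: "nat \<Rightarrow> real \<Rightarrow> real list timed" where
  "constant_vector 0 x = return []"
| "constant_vector (Suc n) x = do {
     xs \<leftarrow> constant_vector n x;
     tick (x # xs)
   }"

text \<open>Adds the product of the sparse matrix and the vector \<open>x\<close> to the vector \<open>y\<close>.\<close>

fun add_product :: "sparse_matrix \<Rightarrow> real list \<Rightarrow> real list \<Rightarrow> real list timed" where
  "add_product [] x y = return y"
| "add_product (e # L) x y = do {
     ((i, j), v) \<leftarrow> tick e;
     a \<leftarrow> tick (x ! j);
     b \<leftarrow> tick (v * a);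
     c \<leftarrow> tick (y ! i);
     d \<leftarrow> tick (c + b);
     y \<leftarrow> tick (y[i := d]);
     add_product L x y
   }"

fun negated_diagonal :: "nat \<Rightarrow> real list \<Rightarrow> sparse_matrix \<Rightarrow> sparse_matrix timed" where
  "negated_diagonal 0 y L = return L"
| "negated_diagonal (Suc i) y L = do {
     a \<leftarrow> tick (y ! i);
     d \<leftarrow> tick (- a);
     L \<leftarrow> tick (((i, i), d) # L);
     negated_diagonal i y L
   }"

definition num_eigenvectors :: "real \<Rightarrow> real \<Rightarrow> real \<Rightarrow> nat" where
  "num_eigenvectors \<epsilon> \<rho> s = nat \<lfloor>\<epsilon> / (\<rho> * s)\<rfloor>"

definition UniversalBasis ::
  "eigensolver \<Rightarrow> real \<Rightarrow> ub_input \<Rightarrow> real \<Rightarrow> real \<Rightarrow> real \<Rightarrow> real mat timed" where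
  "UniversalBasis eig \<delta> I \<epsilon> \<rho> s = do {
     c \<leftarrow> tick (\<rho> * s);
     q \<leftarrow> tick (\<epsilon> / c);
     k \<leftarrow> tick (nat \<lfloor>q\<rfloor>);
     L \<leftarrow> off_diagonal (edges I) (star1 I) [];
     ones \<leftarrow> constant_vector (num_vertices I) 1;
     zeros \<leftarrow> constant_vector (num_vertices I) 0;
     y \<leftarrow> add_product L ones zeros;
     L \<leftarrow> negated_diagonal (num_vertices I) y L;
     eig \<delta> (num_vertices I) L k
   }"

text \<open>
  The relative volume deviation \<open>s\<close> compares the mesh with the Riemannian manifold that it
  triangulates. It and the constant \<open>\<rho>\<close> enter the algorithm only as numbers, and
  are arbitrary here.
\<close>

definition UniversalBasis_inputs ::
  "real \<Rightarrow> (mesh \<times> complex_kind \<times> ub_input \<times> real \<times> real \<times> real \<times> real) set" where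
  "UniversalBasis_inputs \<kappa> =
     {(M, X, I, \<epsilon>, \<rho>, s, \<delta>).
        triangulated_manifold M \<and> well_centered M \<and> shape_regular \<kappa> M \<and> encodes M X I \<and>
        0 < \<rho> \<and> 0 < s \<and> \<rho> * s < \<epsilon> \<and> num_eigenvectors \<epsilon> \<rho> s \<le> num_vertices I \<and>
        0 < \<delta> \<and> \<delta> < 1}"

end

theory Submission
  imports Defs "Jordan_Normal_Form.Char_Poly"
begin

text \<open>
  Apart from the call of the eigensolver, the algorithm takes a number of steps that is linear in
  $n_0 + n_1$, hence bounded by $(k n_1 + k^2 n_0)/\sqrt{\bar\epsilon}$ since $k \ge 1$ and
  $\bar\epsilon < 1$. The bound on the cost of the eigensolver applies because the assembled matrix
  is the Laplacian of a weighted graph: an edge is determined by its two endpoints, so that no two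
  edges are parallel, and the weights are nonnegative because Gram determinants are.
\<close>

section \<open>Nonnegativity of the Hodge star\<close>

text \<open>
  The polynomial $\det(t + G)$ is monic and has no positive root, as \<open>G\<close> is positive semidefinite,
  so it is nonnegative at \<open>0\<close>.
\<close>

lemma Gram_det_nonneg:
  fixes f :: "nat \<Rightarrow> nat \<Rightarrow> real"
  shows "0 \<le> Determinant.det (mat d d (\<lambda>(i, j). \<Sum>k<m. f i k * f j k))" (is "0 \<le> Determinant.det ?G")
proof (rule ccontr)
  assume neg: "\<not> 0 \<le> Determinant.det ?G"
  have A: "- ?G \<in> carrier_mat d d" by simp
  \<comment> \<open>The sign is chosen so that the value of \<open>?p\<close> at t is det(t + G); at
    0 this is the determinant itself, without a factor (-1)^d.\<close>
  let ?p = "char_poly (- ?G)"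
  have "poly ?p 0 = Determinant.det ?G"
    unfolding char_poly_matrix[OF A]
    by (rule arg_cong[where f = Determinant.det], rule eq_matI) (auto simp: char_matrix_def)
  with neg have p0: "poly ?p 0 < 0" by simp
  have "lead_coeff ?p = 1" using degree_monic_char_poly[OF A] by auto
  then obtain N where N: "\<And>x. x \<ge> N \<Longrightarrow> poly ?p x \<ge> 1"
    using poly_pinfty_gt_lc[of ?p] by auto
  \<comment> \<open>The maximum with 1 keeps this point to the right of 0, so the intermediate value
    theorem yields a root that is positive.\<close>
  have "poly ?p (max N 1) > 0" using N[of "max N 1"] by auto
  with p0 have "\<exists>t>0. t < max N 1 \<and> poly ?p t = 0"
    by (intro poly_IVT_pos) (simp_all add: less_max_iff_disj)
  then obtain t where t: "t > 0" "poly ?p t = 0" by blast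
  then obtain v where v: "v \<in> carrier_vec d" "v \<noteq> 0\<^sub>v d" "(- ?G) *\<^sub>v v = t \<cdot>\<^sub>v v"
    using eigenvalue_root_char_poly[OF A, of t] unfolding eigenvalue_def eigenvector_def by auto
  define x where "x i = vec_index v i" for i
  have row: "t * x i = - (\<Sum>j<d. (\<Sum>k<m. f i k * f j k) * x j)" if "i < d" for i
  proof -
    have "vec_index ((- ?G) *\<^sub>v v) i = t * x i" using v that by (simp add: x_def)
    then show ?thesis
      using v(1) that
      by (simp add: x_def scalar_prod_def sum_negf lessThan_atLeast0)
  qed
  \<comment> \<open>Pairing \<open>row\<close> with \<open>x\<close> turns the quadratic form of
    \<open>?G\<close> into a sum of squares over the ambient coordinates k, which contradicts
    \<open>t > 0\<close> unless the eigenvector vanishes.\<close>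
  have "t * (\<Sum>i<d. (x i)\<^sup>2) = (\<Sum>i<d. x i * (t * x i))"
    by (simp add: sum_distrib_left power2_eq_square algebra_simps)
  also have "\<dots> = - (\<Sum>i<d. \<Sum>j<d. \<Sum>k<m. (x i * f i k) * (x j * f j k))"
    by (simp add: row sum_negf sum_distrib_left sum_distrib_right algebra_simps)
  also have "(\<Sum>i<d. \<Sum>j<d. \<Sum>k<m. (x i * f i k) * (x j * f j k))
      = (\<Sum>i<d. \<Sum>k<m. \<Sum>j<d. (x i * f i k) * (x j * f j k))"
    by (intro sum.cong refl sum.swap)
  also have "\<dots> = (\<Sum>k<m. \<Sum>i<d. \<Sum>j<d. (x i * f i k) * (x j * f j k))"
    by (rule sum.swap)
  also have "\<dots> = (\<Sum>k<m. (\<Sum>i<d. x i * f i k)\<^sup>2)"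
    by (simp add: power2_eq_square sum_product)
  finally have "t * (\<Sum>i<d. (x i)\<^sup>2) \<le> 0" by (simp add: sum_nonneg)
  with t have "(\<Sum>i<d. (x i)\<^sup>2) \<le> 0" by (simp add: mult_le_0_iff)
  then have "\<forall>i<d. x i = 0"
    using sum_nonneg_eq_0_iff[of "{..<d}" "\<lambda>i. (x i)\<^sup>2"] sum_nonneg[of "{..<d}" "\<lambda>i. (x i)\<^sup>2"]
    by fastforce
  then have "v = 0\<^sub>v d" using v(1) by (intro eq_vecI) (auto simp: x_def)
  with v show False by simp
qed

text \<open>The real \<open>sqrt\<close> is an odd function, negative on negative arguments, so the
  sign of the Gram determinant decides that of the volume.\<close>

lemma simplex_volume_nonneg: "0 \<le> simplex_volume m ps"
  unfolding simplex_volume_def Let_def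
  by (intro divide_nonneg_nonneg real_sqrt_ge_zero Gram_det_nonneg) auto

text \<open>Both kinds of complex give a quotient of volumes; should a denominator vanish, the
  quotient is 0 by convention.\<close>

lemma hodge_star1_nonneg: "0 \<le> hodge_star1 M X \<tau>"
  by (cases X)
    (auto simp: cell_volume_def dual_cell_volume_def intro!: divide_nonneg_nonneg sum_nonneg simplex_volume_nonneg)

section \<open>Edges and their endpoints\<close>

text \<open>A primal edge is the union of its two endpoints, and a dual edge is the intersection of
  the two top-dimensional simplices that it joins. This rules out parallel edges.\<close>

lemma edge_cell_determined:
  assumes K: "finite_simplicial_complex (mdim M) (simplices M)"
    and \<tau>: "\<tau> \<in> edge_cells M X" "\<tau>' \<in> edge_cells M X"
    and ends: "endpoints M X \<tau> = {a, b}" "endpoints M X \<tau>' = {a, b}" and "a \<noteq> b"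
  shows "\<tau> = \<tau>'"
proof -
  have fin: "finite \<sigma>" if "\<sigma> \<in> simplices M" for \<sigma>
    using K that by (auto simp: finite_simplicial_complex_def)
  show ?thesis
  proof (cases X)
    case Primal
    have ab: "card a = 1" "card b = 1" using ends(1) Primal by auto
    then obtain u w where "a = {u}" "b = {w}" by (auto simp: card_1_singleton_iff)
    with \<open>a \<noteq> b\<close> have 2: "card (a \<union> b) = 2" by simp
    have eq: "\<upsilon> = a \<union> b" if "\<upsilon> \<in> edge_cells M X" "endpoints M X \<upsilon> = {a, b}" for \<upsilon>
    proof -
      have "a \<union> b \<subseteq> \<upsilon>" using that Primal by auto
      moreover have "finite \<upsilon>" "card \<upsilon> = 2" using that Primal fin by auto
      ultimately show ?thesis using 2 by (metis card_subset_eq)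
    qed
    show ?thesis using eq \<tau> ends by metis
  next
    case Circumcentric_Dual
    have "a \<in> endpoints M X \<tau>" "b \<in> endpoints M X \<tau>" using ends(1) by simp_all
    then have ab: "card a = mdim M + 1" "card b = mdim M + 1" "finite a" "finite b"
      using Circumcentric_Dual fin by auto
    \<comment> \<open>Distinct simplices with m + 1 vertices share at most m, where m is
      \<open>mdim M\<close>. A common facet has m vertices, so it fills the whole
      intersection.\<close>
    then have "a \<inter> b \<subset> a"
      using \<open>a \<noteq> b\<close> by (metis card_subset_eq inf_le1 inf_le2 psubsetI)
    then have le: "card (a \<inter> b) \<le> mdim M"
      using psubset_card_mono[of a "a \<inter> b"] ab by simp
    have eq: "\<upsilon> = a \<inter> b" if "\<upsilon> \<in> edge_cells M X" "endpoints M X \<upsilon> = {a, b}" for \<upsilon>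
    proof -
      have "\<upsilon> \<subseteq> a \<inter> b" using that Circumcentric_Dual by auto
      moreover have "card \<upsilon> = mdim M" using that Circumcentric_Dual by auto
      ultimately show ?thesis using le ab by (metis card_seteq finite_Int)
    qed
    show ?thesis using eq \<tau> ends by metis
  qed
qed

section \<open>Sparse matrices\<close>

text \<open>The coefficient function of \<open>to_mat\<close>, freed from the dimension so that
  inductions over the list carry no index bounds.\<close>

definition entry :: "sparse_matrix \<Rightarrow> nat \<times> nat \<Rightarrow> real" where
  "entry L p = (\<Sum>e\<leftarrow>filter (\<lambda>e. fst e = p) L. snd e)"

text \<open>The amount that multiplication by the all-ones vector accumulates in component
  \<open>i\<close>.\<close>

definition row_sum :: "sparse_matrix \<Rightarrow> nat \<Rightarrow> real" where
  "row_sum L i = (\<Sum>e\<leftarrow>filter (\<lambda>e. fst (fst e) = i) L. snd e)"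

lemma entry_Nil [simp]: "entry [] p = 0"
  by (simp add: entry_def)

lemma entry_Cons [simp]: "entry ((q, x) # L) p = (if q = p then x else 0) + entry L p"
  by (simp add: entry_def)

lemma entry_append [simp]: "entry (L @ L') p = entry L p + entry L' p"
  by (simp add: entry_def)

lemma row_sum_Nil [simp]: "row_sum [] i = 0"
  by (simp add: row_sum_def)

lemma row_sum_Cons [simp]: "row_sum ((q, x) # L) i = (if fst q = i then x else 0) + row_sum L i"
  by (simp add: row_sum_def)

lemma entry_not_stored: "p \<notin> set (map fst L) \<Longrightarrow> entry L p = 0"
  by (induction L) auto

text \<open>Regroups the stored entries of a row by column; the bound on the columns ensures that
  none of them is missed.\<close>

lemma row_sum_eq_sum_entry:
  assumes "\<forall>(i, j)\<in>set (map fst L). j < n"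
  shows "row_sum L i = (\<Sum>j<n. entry L (i, j))"
  using assms by (induction L) (auto simp: sum.distrib)

section \<open>Unoriented edges and the assembly of the off-diagonal part\<close>

text \<open>Normal form of an unoriented edge: the input may orient edges either way, whereas
  \<open>sparse_graph_Laplacian\<close> expects the smaller end first.\<close>

definition ordered_pair :: "nat \<times> nat \<Rightarrow> nat \<times> nat" where
  "ordered_pair = (\<lambda>(i, j). (min i j, max i j))"

lemma ordered_pair_eq_iff: "ordered_pair p = ordered_pair q \<longleftrightarrow> p = q \<or> p = prod.swap q"
  by (cases p; cases q) (auto simp: ordered_pair_def min_def max_def)

text \<open>One round of the loop with the monad unfolded, where 5 counts its ticks. The inductions
  below use it in place of the defining equations.\<close>

lemma off_diagonal_Cons:
  "off_diagonal ((i, j) # es) (w # ws) L =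
     (let c = off_diagonal es ws (((j, i), - w) # ((i, j), - w) # L) in Timed (result c) (5 + cost c))"
  by (simp add: tick_def bind_timed_def Let_def)

lemma off_diagonal_Nil: "off_diagonal [] [] L = Timed L 0"
  by (simp add: return_def)

lemma off_diagonal_length:
  assumes "length es = length ws"
  shows "length (result (off_diagonal es ws L)) = length L + 2 * length es"
  using assms
  by (induction es ws arbitrary: L rule: list_induct2)
    (auto simp: off_diagonal_Cons off_diagonal_Nil Let_def simp del: off_diagonal.simps)

lemma off_diagonal_cost:
  assumes "length es = length ws"
  shows "cost (off_diagonal es ws L) = 5 * length es"
  using assms
  by (induction es ws arbitrary: L rule: list_induct2)
    (auto simp: off_diagonal_Cons off_diagonal_Nil Let_def simp del: off_diagonal.simps)

lemma off_diagonal_stored: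
  assumes "length es = length ws"
  shows "set (map fst (result (off_diagonal es ws L))) = set es \<union> (set es)\<inverse> \<union> set (map fst L)"
  using assms
proof (induction es ws arbitrary: L rule: list_induct2)
  case Nil
  then show ?case by (simp add: off_diagonal_Nil del: off_diagonal.simps)
next
  case (Cons e es w ws)
  have "(set (e # es))\<inverse> = insert (snd e, fst e) ((set es)\<inverse>)" by (cases e) auto
  with Cons.IH show ?case
    by (cases e) (simp add: off_diagonal_Cons Let_def insert_commute Un_commute del: off_diagonal.simps)
qed

text \<open>The last two hypotheses are the loop invariant on the accumulator. It survives a round
  because an edge with a different normal form occupies neither \<open>(i, j)\<close> nor
  \<open>(j, i)\<close>, and these two differ as loops are excluded.\<close>

lemma off_diagonal_distinct:
  assumes "length es = length ws" "distinct (map ordered_pair es)" "\<forall>(i, j)\<in>set es. i \<noteq> j"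
    "distinct (map fst L)" "\<forall>e\<in>set es. e \<notin> fst ` set L \<and> prod.swap e \<notin> fst ` set L"
  shows "distinct (map fst (result (off_diagonal es ws L)))"
  using assms
proof (induction es ws arbitrary: L rule: list_induct2)
  case Nil
  then show ?case by (simp add: off_diagonal_Nil del: off_diagonal.simps)
next
  case (Cons e es w ws)
  obtain i j where e: "e = (i, j)" by fastforce
  let ?L = "((j, i), - w) # ((i, j), - w) # L"
  have keys: "fst ` set ?L = {(i, j), (j, i)} \<union> fst ` set L" by auto
  have "distinct (map fst (result (off_diagonal es ws ?L)))"
  proof (rule Cons.IH)
    show "distinct (map ordered_pair es)" using Cons.prems by simp
    show "\<forall>(i, j)\<in>set es. i \<noteq> j" using Cons.prems by simp
    have "i \<noteq> j" "(i, j) \<notin> fst ` set L" "(j, i) \<notin> fst ` set L"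
      using Cons.prems(2,4) by (simp_all add: e)
    then show "distinct (map fst ?L)" using Cons.prems(3) by simp
    show "\<forall>q\<in>set es. q \<notin> fst ` set ?L \<and> prod.swap q \<notin> fst ` set ?L"
    proof
      fix q assume q: "q \<in> set es"
      then have "ordered_pair q \<noteq> ordered_pair e" using Cons.prems(1) by (metis distinct.simps(2) image_eqI list.map(2) list.set_map)
      then have "q \<notin> {(i, j), (j, i)}" "prod.swap q \<notin> {(i, j), (j, i)}"
        by (cases q; auto simp: ordered_pair_eq_iff e)+
      moreover have "q \<notin> fst ` set L" "prod.swap q \<notin> fst ` set L"
        using Cons.prems(4) q by (meson list.set_intros(2))+
      ultimately show "q \<notin> fst ` set ?L \<and> prod.swap q \<notin> fst ` set ?L" by (metis UnE keys)
    qed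
  qed
  then show ?case by (simp add: off_diagonal_Cons e Let_def del: off_diagonal.simps)
qed

text \<open>A closed form that is invariant under swapping \<open>p\<close> and monotone in the
  weights, from which symmetry and sign of the matrix are read off next.\<close>

lemma off_diagonal_entry:
  assumes "length es = length ws"
  shows "entry (result (off_diagonal es ws L)) p =
    entry L p - (\<Sum>(e, w)\<leftarrow>zip es ws. (if e = p then w else 0) + (if e = prod.swap p then w else 0))"
  using assms
proof (induction es ws arbitrary: L rule: list_induct2)
  case Nil
  then show ?case by (simp add: off_diagonal_Nil del: off_diagonal.simps)
next
  case (Cons e es w ws)
  obtain i j where e: "e = (i, j)" by fastforce
  have swap: "(j, i) = p \<longleftrightarrow> (i, j) = prod.swap p" by (cases p) auto
  have "entry (result (off_diagonal (e # es) (w # ws) L)) p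
      = entry (result (off_diagonal es ws (((j, i), - w) # ((i, j), - w) # L))) p"
    unfolding e off_diagonal_Cons Let_def by simp
  also note Cons.IH
  finally show ?case
    unfolding entry_Cons swap e by simp
qed

lemma off_diagonal_symmetric:
  assumes "length es = length ws"
  shows "entry (result (off_diagonal es ws [])) (i, j) = entry (result (off_diagonal es ws [])) (j, i)"
  by (simp add: off_diagonal_entry[OF assms] add.commute)

lemma off_diagonal_nonpos:
  assumes "length es = length ws" "\<forall>w\<in>set ws. 0 \<le> w"
  shows "entry (result (off_diagonal es ws [])) p \<le> 0"
proof -
  let ?g = "\<lambda>(e, w). (if e = p then w else 0) + (if e = prod.swap p then w else 0)"
  have "0 \<le> sum_list (map ?g (zip es ws))"
  proof (rule sum_list_nonneg, unfold set_map, erule imageE)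
    fix x y assume x: "x = ?g y" and y: "y \<in> set (zip es ws)"
    obtain e w where ew: "y = (e, w)" by fastforce
    have "0 \<le> w" using assms(2) set_zip_rightD[of e w] y ew by blast
    then show "0 \<le> x" by (simp add: x ew)
  qed
  then show ?thesis by (simp add: off_diagonal_entry[OF assms(1)])
qed

section \<open>Results and costs of the vector operations and the diagonal\<close>

lemma constant_vector_result [simp]: "result (constant_vector n x) = replicate n x"
  by (induction n) (auto simp: return_def tick_def bind_timed_def)

lemma constant_vector_cost [simp]: "cost (constant_vector n x) = n"
  by (induction n) (auto simp: return_def tick_def bind_timed_def)

lemma add_product_cost: "cost (add_product L x y) = 6 * length L"
  by (induction L x y rule: add_product.induct)
    (auto simp: return_def tick_def bind_timed_def split: prod.splits)

text \<open>The bounds on the positions keep every lookup in the vector of ones and every update of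
  the accumulator in range. The accumulator is arbitrary for the induction.\<close>

lemma add_product_ones:
  assumes "\<forall>(i, j)\<in>set (map fst L). i < n \<and> j < n" "length y = n" "i < n"
  shows "result (add_product L (replicate n 1) y) ! i = y ! i + row_sum L i"
  using assms
proof (induction L arbitrary: y)
  case Nil
  then show ?case by (simp add: return_def)
next
  case (Cons e L)
  obtain p q v where e: "e = ((p, q), v)" by (metis surj_pair)
  show ?case
    using Cons.IH[of "y[p := y ! p + v]"] Cons.prems
    by (auto simp: tick_def bind_timed_def e nth_list_update)
qed

lemma negated_diagonal_result:
  "result (negated_diagonal n y L) = map (\<lambda>i. ((i, i), - (y ! i))) [0..<n] @ L"
  by (induction n y L rule: negated_diagonal.induct) (auto simp: return_def tick_def bind_timed_def)

lemma negated_diagonal_cost: "cost (negated_diagonal n y L) = 3 * n"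
  by (induction n y L rule: negated_diagonal.induct) (auto simp: return_def tick_def bind_timed_def)

section \<open>The assembled matrix\<close>

lemma entry_diagonal:
  "entry (map (\<lambda>i. ((i, i), g i)) [0..<n]) (i, j) = (if i = j \<and> i < n then g i else 0)"
  by (induction n) auto

text \<open>The edge weights are the negated off-diagonal entries. The negated row sums are then the
  weighted degrees, since the off-diagonal part is symmetric and has zero diagonal.\<close>

lemma assembled_Laplacian:
  assumes len: "length es = length ws" and dist_es: "distinct (map ordered_pair es)"
    and es: "\<forall>(i, j)\<in>set es. i \<noteq> j \<and> i < n \<and> j < n" and ws: "\<forall>w\<in>set ws. 0 \<le> w"
  defines "L0 \<equiv> result (off_diagonal es ws [])"
  defines "y \<equiv> result (add_product L0 (replicate n 1) (replicate n 0))"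
  shows "sparse_graph_Laplacian n (ordered_pair ` set es) (result (negated_diagonal n y L0))"
proof -
  define E where "E = ordered_pair ` set es"
  let ?L = "result (negated_diagonal n y L0)"
  have es': "i \<noteq> j \<and> i < n \<and> j < n" if "(i, j) \<in> set es" for i j using es that by auto
  have E_iff: "(i, j) \<in> E \<longleftrightarrow> i \<le> j \<and> ((i, j) \<in> set es \<or> (j, i) \<in> set es)" for i j
  proof
    assume "(i, j) \<in> E"
    then obtain a b where "(a, b) \<in> set es" "(i, j) = ordered_pair (a, b)"
      unfolding E_def by (metis imageE surj_pair)
    then show "i \<le> j \<and> ((i, j) \<in> set es \<or> (j, i) \<in> set es)"
      by (cases "a \<le> b") (simp_all add: ordered_pair_def min_def max_def)
  next
    assume ij: "i \<le> j \<and> ((i, j) \<in> set es \<or> (j, i) \<in> set es)"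
    then have "ordered_pair (i, j) = (i, j)" "ordered_pair (j, i) = (i, j)"
      by (simp_all add: ordered_pair_def)
    with ij show "(i, j) \<in> E" unfolding E_def by (metis imageI)
  qed
  have E_less: "i < j \<and> j < n" if "(i, j) \<in> E" for i j
    using that es'[of i j] es'[of j i] by (auto simp: E_iff)
  then have irrefl: "(i, i) \<notin> E" for i by blast
  have "(i, j) \<in> E \<union> E\<inverse> \<longleftrightarrow> (i, j) \<in> set es \<union> (set es)\<inverse>" for i j
    unfolding Un_iff converse_iff E_iff using linear[of i j] by blast
  then have "E \<union> E\<inverse> = set es \<union> (set es)\<inverse>" by (intro subset_antisym subrelI) blast+
  then have stored: "set (map fst L0) = E \<union> E\<inverse>"
    unfolding L0_def off_diagonal_stored[OF len] by simp
  have dist: "distinct (map fst L0)"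
    unfolding L0_def using es by (intro off_diagonal_distinct len dist_es) auto
  have sym: "entry L0 (i, j) = entry L0 (j, i)" for i j
    unfolding L0_def by (rule off_diagonal_symmetric[OF len])
  have nonpos: "entry L0 p \<le> 0" for p
    unfolding L0_def by (rule off_diagonal_nonpos[OF len ws])
  have zero: "entry L0 (i, j) = 0" if "(i, j) \<notin> E" "(j, i) \<notin> E" for i j
    using that by (intro entry_not_stored) (simp add: stored del: set_map)
  have range: "\<forall>(i, j)\<in>set (map fst L0). i < n \<and> j < n"
    unfolding stored using E_less by (fastforce dest: less_trans)
  have y: "y ! i = row_sum L0 i" if "i < n" for i
    using add_product_ones[OF range, of "replicate n 0" i] that by (simp add: y_def)
  have row: "row_sum L0 i = (\<Sum>e\<in>{e\<in>E. i = fst e \<or> i = snd e}. entry L0 e)" for i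
  proof -
    have "row_sum L0 i = (\<Sum>j<n. entry L0 (i, j))"
      using range by (intro row_sum_eq_sum_entry) fast
    also have "\<dots> = (\<Sum>j\<in>{j. (i, j) \<in> E \<or> (j, i) \<in> E}. entry L0 (i, j))"
    proof (rule sum.mono_neutral_right)
      show "{j. (i, j) \<in> E \<or> (j, i) \<in> E} \<subseteq> {..<n}" using E_less by (force dest: less_trans)
    qed (use zero in auto)
    \<comment> \<open>Neighbours of \<open>i\<close> correspond to incident edges, each edge being
      sent back to its other end. Symmetry allows the entry to be read at the ordered
      position.\<close>
    also have "\<dots> = (\<Sum>e\<in>{e\<in>E. i = fst e \<or> i = snd e}. entry L0 e)"
    proof (rule sum.reindex_bij_witness[where j = "\<lambda>j. ordered_pair (i, j)"
          and i = "\<lambda>e. if fst e = i then snd e else fst e"])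
      fix j assume "j \<in> {j. (i, j) \<in> E \<or> (j, i) \<in> E}"
      then have "i < j \<and> (i, j) \<in> E \<or> j < i \<and> (j, i) \<in> E" using E_less by blast
      then show "ordered_pair (i, j) \<in> {e\<in>E. i = fst e \<or> i = snd e}"
        by (auto simp: ordered_pair_def)
      show "(if fst (ordered_pair (i, j)) = i then snd (ordered_pair (i, j)) else fst (ordered_pair (i, j))) = j"
        by (auto simp: ordered_pair_def)
      show "entry L0 (ordered_pair (i, j)) = entry L0 (i, j)"
        by (cases "i \<le> j") (simp_all add: ordered_pair_def min_def max_def sym[of j i])
    next
      fix e assume e: "e \<in> {e\<in>E. i = fst e \<or> i = snd e}"
      then have "fst e < snd e" using E_less[of "fst e" "snd e"] by simp
      then show "ordered_pair (i, if fst e = i then snd e else fst e) = e"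
        using e by (cases e) (auto simp: ordered_pair_def)
      show "(if fst e = i then snd e else fst e) \<in> {j. (i, j) \<in> E \<or> (j, i) \<in> E}"
        using e by (cases e) auto
    qed
    finally show ?thesis .
  qed
  have L: "?L = map (\<lambda>i. ((i, i), - (y ! i))) [0..<n] @ L0"
    by (rule negated_diagonal_result)
  have keys: "map fst ?L = map (\<lambda>i. (i, i)) [0..<n] @ map fst L0" by (simp add: L)
  have "set (map (\<lambda>i. (i, i)) [0..<n]) \<inter> set (map fst L0) = {}"
    unfolding stored using irrefl by auto
  moreover have "distinct (map (\<lambda>i. (i, i)) [0..<n])" by (simp add: distinct_map inj_on_def)
  ultimately have L_dist: "distinct (map fst ?L)"
    unfolding keys distinct_append using dist by blast
  have L_keys: "set (map fst ?L) = {(i, i) |i. i < n} \<union> E \<union> E\<inverse>"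
    unfolding keys set_append stored by auto
  \<comment> \<open>The double negations reproduce the shape of
    \<open>sparse_graph_Laplacian\<close> for the weight function
    \<open>\<lambda>e. - entry L0 e\<close>.\<close>
  have L_mat: "to_mat n ?L = mat n n (\<lambda>(i, j).
          if i = j then \<Sum>e\<in>{e\<in>E. i = fst e \<or> i = snd e}. - entry L0 e
          else if (i, j) \<in> E then - (- entry L0 (i, j))
          else if (j, i) \<in> E then - (- entry L0 (j, i))
          else 0)" (is "_ = mat n n ?F")
  proof -
    have "entry ?L (i, j) = ?F (i, j)" if "i < n" "j < n" for i j
    proof (cases "i = j")
      case True
      have "entry L0 (i, i) = 0" by (intro zero irrefl)
      then show ?thesis using True that by (simp add: L entry_diagonal y row sum_negf)
    next
      case False
      then show ?thesis using sym[of i j] zero[of i j] by (simp add: L entry_diagonal)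
    qed
    then show ?thesis unfolding to_mat_def entry_def[symmetric] by (intro cong_mat) auto
  qed
  have "sparse_graph_Laplacian n E ?L"
    unfolding sparse_graph_Laplacian_def
  proof (intro conjI exI[of _ "\<lambda>e. - entry L0 e"])
    show "E \<subseteq> {(i, j). i < j \<and> j < n}" using E_less by auto
    show "\<forall>e\<in>E. 0 \<le> - entry L0 e" using nonpos by simp
  qed (fact L_dist L_keys L_mat)+
  then show ?thesis unfolding E_def .
qed

section \<open>The weighted graph encoded by a mesh\<close>

text \<open>Supplies the hypotheses of \<open>assembled_Laplacian\<close>, and identifies the sizes
  of the input with the numbers of cells in the cost bound.\<close>

lemma encodes_graph:
  assumes K: "finite_simplicial_complex (mdim M) (simplices M)" and "encodes M X I"
  shows "card (vertex_cells M X) = num_vertices I" "card (edge_cells M X) = length (edges I)"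
    "length (edges I) = length (star1 I)" "distinct (map ordered_pair (edges I))"
    "\<forall>(i, j)\<in>set (edges I). i \<noteq> j \<and> i < num_vertices I \<and> j < num_vertices I"
    "\<forall>w\<in>set (star1 I). 0 \<le> w"
proof -
  obtain \<tau>0 \<tau>1 where
    b0: "bij_betw \<tau>0 {..<num_vertices I} (vertex_cells M X)" and
    b1: "bij_betw \<tau>1 {..<length (edges I)} (edge_cells M X)" and
    len: "length (star1 I) = length (edges I)" and
    ew: "\<forall>l<length (edges I).
           (case edges I ! l of (i, j) \<Rightarrow>
              i < num_vertices I \<and> j < num_vertices I \<and> i \<noteq> j \<and>
              endpoints M X (\<tau>1 l) = {\<tau>0 i, \<tau>0 j}) \<and>
           star1 I ! l = hodge_star1 M X (\<tau>1 l)"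
    using assms(2) unfolding encodes_def by blast
  have e: "i < num_vertices I \<and> j < num_vertices I \<and> i \<noteq> j \<and> endpoints M X (\<tau>1 l) = {\<tau>0 i, \<tau>0 j}"
    if "l < length (edges I)" "edges I ! l = (i, j)" for l i j
    using ew[rule_format, OF that(1)] unfolding that(2) prod.case by blast
  have w: "star1 I ! l = hodge_star1 M X (\<tau>1 l)" if "l < length (edges I)" for l
    using ew that by blast
  show "card (vertex_cells M X) = num_vertices I" using bij_betw_same_card[OF b0] by simp
  show "card (edge_cells M X) = length (edges I)" using bij_betw_same_card[OF b1] by simp
  show "length (edges I) = length (star1 I)" using len by simp
  show "\<forall>(i, j)\<in>set (edges I). i \<noteq> j \<and> i < num_vertices I \<and> j < num_vertices I"
  proof clarify
    fix i j assume "(i, j) \<in> set (edges I)"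
    then obtain l where "l < length (edges I)" "edges I ! l = (i, j)" by (auto simp: in_set_conv_nth)
    from e[OF this] show "i \<noteq> j \<and> i < num_vertices I \<and> j < num_vertices I" by blast
  qed
  show "\<forall>w\<in>set (star1 I). 0 \<le> w"
    using w len hodge_star1_nonneg by (auto simp: in_set_conv_nth)
  show "distinct (map ordered_pair (edges I))"
  proof -
    \<comment> \<open>Equal normal forms give equal sets of endpoints, hence the same edge cell by
      \<open>edge_cell_determined\<close>, and \<open>\<tau>1\<close> is injective.\<close>
    have inj: "l = l'"
      if l: "l < length (edges I)" "l' < length (edges I)"
        and eq: "ordered_pair (edges I ! l) = ordered_pair (edges I ! l')" for l l'
    proof -
      obtain i j where ij: "edges I ! l = (i, j)" by fastforce
      from eq have "edges I ! l' = (i, j) \<or> edges I ! l' = (j, i)"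
        by (cases "edges I ! l'") (auto simp: ordered_pair_eq_iff ij)
      then have ends: "endpoints M X (\<tau>1 l') = {\<tau>0 i, \<tau>0 j}"
        by (elim disjE) (drule e[OF l(2)], simp add: insert_commute)+
      have "\<tau>0 i \<noteq> \<tau>0 j"
        using e[OF l(1) ij] b0 by (metis bij_betw_def inj_onD lessThan_iff)
      moreover have "\<tau>1 l \<in> edge_cells M X" "\<tau>1 l' \<in> edge_cells M X"
        using b1 l by (auto simp: bij_betw_def)
      ultimately have "\<tau>1 l = \<tau>1 l'"
        using edge_cell_determined[OF K] e[OF l(1) ij] ends by metis
      then show ?thesis using b1 l by (metis bij_betw_def inj_onD lessThan_iff)
    qed
    show ?thesis unfolding distinct_conv_nth using inj by (metis length_map nth_map)
  qed
qed

section \<open>The total running time\<close>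

theorem proposition3:
  fixes eig :: eigensolver and \<kappa> :: real
  assumes "is_LaplacianEig eig" and "0 < \<kappa>"
  shows "(\<lambda>(M, X, I, \<epsilon>, \<rho>, s, \<delta>). real (cost (UniversalBasis eig \<delta> I \<epsilon> \<rho> s)))
           \<in> O[principal (UniversalBasis_inputs \<kappa>)](\<lambda>(M, X, I, \<epsilon>, \<rho>, s, \<delta>).
               (let n0 = real (card (vertex_cells M X));
                    n1 = real (card (edge_cells M X));
                    k = real (num_eigenvectors \<epsilon> \<rho> s)
                in (k * n1 + k\<^sup>2 * n0) / sqrt \<delta>))"
proof -
  obtain C where C: "C > 0" and eig: "\<And>\<delta> n E L k. (\<delta>, n, E, L, k) \<in> eigensolver_inputs \<Longrightarrow>
      real (cost (eig \<delta> n L k)) \<le> C * ((real (card E) * real k + real n * (real k)\<^sup>2) / sqrt \<delta>)"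
  proof -
    \<comment> \<open>On a principal filter "eventually" means everywhere on the set, so a single
      constant serves all admissible inputs.\<close>
    from assms(1) obtain C where "C > 0" and C: "\<forall>x\<in>eigensolver_inputs.
        norm (case x of (\<delta>, n, E, L, k) \<Rightarrow> real (cost (eig \<delta> n L k)))
        \<le> C * norm (case x of (\<delta>, n, E, L, k) \<Rightarrow> (real (card E) * real k + real n * (real k)\<^sup>2) / sqrt \<delta>)"
      unfolding is_LaplacianEig_def bigo_def eventually_principal by auto
    show thesis
    proof (rule that[OF \<open>C > 0\<close>])
      fix \<delta> n E L k assume x: "(\<delta>, n, E, L, k) \<in> eigensolver_inputs"
      then have "0 < \<delta>" by (simp add: eigensolver_inputs_def)
      with C[rule_format, OF x] show "real (cost (eig \<delta> n L k))
          \<le> C * ((real (card E) * real k + real n * (real k)\<^sup>2) / sqrt \<delta>)"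
        by (simp add: abs_of_nonneg)
    qed
  qed
  have bound: "real (cost (UniversalBasis eig \<delta> I \<epsilon> \<rho> s))
      \<le> (25 + C) * ((real k * real n1 + (real k)\<^sup>2 * real n0) / sqrt \<delta>)"
    if x: "(M, X, I, \<epsilon>, \<rho>, s, \<delta>) \<in> UniversalBasis_inputs \<kappa>"
      and n0: "n0 = card (vertex_cells M X)" and n1: "n1 = card (edge_cells M X)"
      and k: "k = num_eigenvectors \<epsilon> \<rho> s" for M X I \<epsilon> \<rho> s \<delta> n0 n1 k
  proof -
    let ?B = "(real k * real n1 + (real k)\<^sup>2 * real n0) / sqrt \<delta>"
    have K: "finite_simplicial_complex (mdim M) (simplices M)" and enc: "encodes M X I"
      and pos: "0 < \<rho>" "0 < s" "\<rho> * s < \<epsilon>" "0 < \<delta>" "\<delta> < 1" and kn: "k \<le> num_vertices I"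
      using x k by (auto simp: UniversalBasis_inputs_def triangulated_manifold_def)
    note G = encodes_graph[OF K enc]
    \<comment> \<open>The floor of a quotient above 1 is at least 1. This makes the eigensolver call
      admissible and later lets \<open>k\<close> absorb the linear terms.\<close>
    have "1 < \<epsilon> / (\<rho> * s)" using pos by (simp add: field_simps)
    then have k1: "1 \<le> k" unfolding k num_eigenvectors_def by linarith
    define L0 where "L0 = result (off_diagonal (edges I) (star1 I) [])"
    define L where "L = result (negated_diagonal n0
      (result (add_product L0 (replicate n0 1) (replicate n0 0))) L0)"
    let ?E = "ordered_pair ` set (edges I)"
    \<comment> \<open>Without parallel edges, passing to normal forms loses no edge, so the solver's
      bound is in terms of \<open>n1\<close> itself.\<close>
    have cardE: "card ?E = n1"
      using distinct_card[OF G(4)] G(2) n1 by simp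
    have "sparse_graph_Laplacian n0 ?E L"
      unfolding L_def L0_def n0 G(1) by (rule assembled_Laplacian[OF G(3,4,5,6)])
    then have "(\<delta>, n0, ?E, L, k) \<in> eigensolver_inputs"
      using pos k1 kn n0 G(1) by (simp add: eigensolver_inputs_def)
    from eig[OF this] have eigcost: "real (cost (eig \<delta> n0 L k)) \<le> C * ?B"
      by (simp add: cardE mult.commute)
    \<comment> \<open>Three ticks compute \<open>k\<close>. Each edge costs 5 for storing its two
      entries and 6 for each of them in the product; each vertex costs 2 for the constant vectors
      and 3 for the diagonal.\<close>
    have "cost (UniversalBasis eig \<delta> I \<epsilon> \<rho> s) = 3 + 17 * n1 + 5 * n0 + cost (eig \<delta> n0 L k)"
      using G(1-3) off_diagonal_length[OF G(3), of "[]"] off_diagonal_cost[OF G(3), of "[]"]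
      unfolding UniversalBasis_def bind_timed_def tick_def
      by (simp add: n0 n1 k L_def L0_def num_eigenvectors_def add_product_cost negated_diagonal_cost)
    moreover have "real (3 + 17 * n1 + 5 * n0) \<le> 25 * ?B"
    proof -
      \<comment> \<open>At least one vertex is present, so the additive 3 is absorbed into the
        multiple of \<open>n0\<close>.\<close>
      have "1 \<le> n0" using k1 kn n0 G(1) by simp
      then have "real (3 + 17 * n1 + 5 * n0) \<le> 25 * (real n1 + real n0)" by simp
      also have "real n1 + real n0 \<le> real k * real n1 + (real k)\<^sup>2 * real n0"
        using k1 mult_right_mono[of 1 "real k" "real n1"] mult_right_mono[of 1 "(real k)\<^sup>2" "real n0"]
        by (intro add_mono) auto
      also have "\<dots> \<le> ?B"
        using pos by (simp add: pos_le_divide_eq mult_left_le)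
      finally show ?thesis by simp
    qed
    ultimately show ?thesis unfolding distrib_right using eigcost by linarith
  qed
  show ?thesis
  proof (rule bigoI[where c = "25 + C"], unfold eventually_principal, rule ballI)
    fix x assume x: "x \<in> UniversalBasis_inputs \<kappa>"
    obtain M X I \<epsilon> \<rho> s \<delta> where [simp]: "x = (M, X, I, \<epsilon>, \<rho>, s, \<delta>)" by (metis surj_pair)
    have "0 < \<delta>" using x by (simp add: UniversalBasis_inputs_def)
    then show "norm (case x of (M, X, I, \<epsilon>, \<rho>, s, \<delta>) \<Rightarrow> real (cost (UniversalBasis eig \<delta> I \<epsilon> \<rho> s)))
      \<le> (25 + C) * norm (case x of (M, X, I, \<epsilon>, \<rho>, s, \<delta>) \<Rightarrow>
               (let n0 = real (card (vertex_cells M X));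
                    n1 = real (card (edge_cells M X));
                    k = real (num_eigenvectors \<epsilon> \<rho> s)
                in (k * n1 + k\<^sup>2 * n0) / sqrt \<delta>))"
      using bound[OF _ refl refl refl] x by (simp add: Let_def abs_of_nonneg)
  qed
qed

end
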